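(* For all integers $n>p\ge 0$, $$\sum_{k=p+1}^{n}\binom{n}{k}{k\brace p+1}B_{n-k,p}=\frac{p^{\,n-1}\,(n-pH_{p})}{p!}+\sum_{j=1}^{p}{n\brace p-j}\frac{H_{j}}{j!}.$$
   Context: The $p$-Bernoulli numbers $B_{n,p}$ ($n\ge 0$, $p\ge 0$ integers) are the rational numbers determined by $B_{0,p}=1$ for all $p\ge 0$ and the recursion $$B_{n+1,p}=p\,B_{n,p}-\frac{(p+1)^{2}}{p+2}\,B_{n,p+1}.$$ Equivalently, $B_{n,p}=\sum_{k=0}^{n}(-1)^{k}{n\brace k}\binom{k+p+1}{k}^{-1}k!$. In particular $B_{n,0}=B_n$ is the $n$th Bernoulli number. ${n\brace k}$ denotes the Stirling number of the second kind, i.e. $\sum_{n\ge 0}{n\brace k}\frac{t^n}{n!}=\frac{(e^t-1)^k}{k!}$. $H_n=\sum_{j=1}^{n}\frac1j$ is the $n$th harmonic number, with $H_0=0$; empty sums are $0$. The convention $0^0=1$ is used (relevant for $p=0$, $n=1$). *)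

theory Defs
  imports "HOL-Analysis.Harmonic_Numbers" "HOL-Combinatorics.Stirling"
begin

text \<open>
  The $p$-Bernoulli numbers $B_{n,p}$, with $n$ as the first argument. They are rational, but
  are taken in the type of reals, where the harmonic numbers \<^term>\<open>harm\<close> live.
\<close>

fun p_bernoulli :: "nat \<Rightarrow> nat \<Rightarrow> real" where
  "p_bernoulli 0 p = 1"
| "p_bernoulli (Suc n) p =
     real p * p_bernoulli n p - (real p + 1)\<^sup>2 / (real p + 2) * p_bernoulli n (Suc p)"

lemma p_bernoulli_in_Rats: "p_bernoulli n p \<in> \<rat>"
proof (induction n arbitrary: p)
  case (Suc n)
  have "real p + 1 \<in> \<rat>" "real p + 2 \<in> \<rat>"
    by (auto intro: Rats_add)
  with Suc show ?case
    by (auto intro!: Rats_diff Rats_mult Rats_divide Rats_power)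
qed auto

end

theory Submission
  imports Defs "HOL-Computational_Algebra.Formal_Power_Series"
begin

unbundle no vec_syntax
unbundle fps_syntax

text \<open>
  With $u = e^t - 1$, the exponential generating function of $n \mapsto B_{n,p}$ is the
  hypergeometric series $F_p(u) = \sum_k (-1)^k \frac{(p+1)!\,k!}{(k+p+1)!} u^k$. Since $u^{p+1}/(p+1)!$
  generates the Stirling numbers, the left-hand side is $n!$ times the coefficient of $t^n$ in
  $G_p(u) = u^{p+1} F_p(u) / (p+1)!$. As a series in $u$, $G_p$ is the $(p+1)$-fold antiderivative of
  $1/(1+u)$ that vanishes to order $p + 1$ at $0$, so that $dG_{p+1}/dt = e^t G_p$. Integrating this
  repeatedly from $G_0 = t$ gives
  $G_p = e^{pt}(t - H_p)/p! + \sum_{j=0}^{p} \frac{H_j}{j!} \frac{u^{p-j}}{(p-j)!}$.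
\<close>

definition expm1 :: "real fps" where
  "expm1 = fps_exp 1 - 1"

lemma expm1_nth_0 [simp]: "expm1 $ 0 = 0"
  by (simp add: expm1_def)

lemma fps_deriv_expm1: "fps_deriv expm1 = 1 + expm1"
  by (simp add: expm1_def)

lemma fps_deriv_expm1_power_Suc:
  "fps_deriv (expm1 ^ Suc m) = of_nat (Suc m) * (expm1 ^ Suc m + expm1 ^ m)"
  by (simp only: fps_deriv_power' fps_deriv_expm1) (simp add: algebra_simps)

text \<open>Comparing coefficients in the derivative of \<open>expm1 ^ Suc k\<close> reproduces the
  triangular recurrence of the Stirling numbers.\<close>

lemma fps_nth_expm1_power: "(expm1 ^ m) $ n = fact m * real (Stirling n m) / fact n"
proof (induction n m rule: Stirling.induct)
  case (4 n k)
  have "real (Suc n) * (expm1 ^ Suc k) $ Suc n = fps_deriv (expm1 ^ Suc k) $ n"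
    by (simp del: power_Suc)
  also have "\<dots> = real (Suc k) * ((expm1 ^ Suc k) $ n + (expm1 ^ k) $ n)"
    by (simp only: fps_deriv_expm1_power_Suc fps_of_nat [symmetric] fps_mult_left_const_nth
        fps_add_nth)
  also have "\<dots> = fact (Suc k) * real (Stirling (Suc n) (Suc k)) / fact n"
    unfolding 4 by (simp add: field_simps)
  finally show ?case
    by (simp add: divide_simps del: power_Suc Stirling.simps)
      (simp add: algebra_simps del: power_Suc Stirling.simps)
qed simp_all

text \<open>The Gauss series 2F1(1, 1; p + 2; -u), written with factorials.\<close>

definition bernoulli_series :: "nat \<Rightarrow> real fps" where
  "bernoulli_series p = Abs_fps (\<lambda>k. (-1) ^ k * fact (Suc p) * fact k / fact (Suc (k + p)))"

text \<open>The recursion of \<open>p_bernoulli\<close> in the variable u, where d/dt acts as (1 +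
  u) d/du.\<close>

lemma bernoulli_series_ODE:
  "(1 + fps_X) * fps_deriv (bernoulli_series p) =
     fps_const (real p) * bernoulli_series p
     - fps_const ((real p + 1)\<^sup>2 / (real p + 2)) * bernoulli_series (Suc p)"
proof (rule fps_ext)
  fix k
  define a where "a = bernoulli_series p $ k"
  \<comment> \<open>Both neighbouring coefficients are rational multiples of \<open>a\<close>, so
    the claim becomes an identity of rational functions in k and p.\<close>
  have next_k: "bernoulli_series p $ Suc k = - a * (real k + 1) / (real k + real p + 2)"
    by (simp add: a_def bernoulli_series_def divide_simps) (simp add: algebra_simps)
  have next_p: "bernoulli_series (Suc p) $ k = a * (real p + 2) / (real k + real p + 2)"
    by (simp add: a_def bernoulli_series_def divide_simps) (simp add: algebra_simps)
  have "((1 + fps_X) * fps_deriv (bernoulli_series p)) $ k =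
      (real k + 1) * bernoulli_series p $ Suc k + real k * a"
    by (cases k) (simp_all add: distrib_right a_def)
  moreover have "real k + real p + 2 \<noteq> 0" "real p + 2 \<noteq> 0"
    by linarith+
  ultimately show "((1 + fps_X) * fps_deriv (bernoulli_series p)) $ k =
     (fps_const (real p) * bernoulli_series p
     - fps_const ((real p + 1)\<^sup>2 / (real p + 2)) * bernoulli_series (Suc p)) $ k"
    by (simp add: next_k next_p a_def [symmetric] divide_simps)
      (simp add: algebra_simps power2_eq_square)
qed

lemma fps_deriv_compose_expm1:
  "fps_deriv (f oo expm1) = ((1 + fps_X) * fps_deriv f) oo expm1"
  by (simp add: fps_compose_deriv fps_compose_mult_distrib fps_compose_add_distrib
      fps_deriv_expm1 mult.commute)

text \<open>The differential equation yields the defining recursion coefficientwise; the index p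
  stays arbitrary because that recursion raises it.\<close>

lemma p_bernoulli_egf: "(bernoulli_series p oo expm1) $ n = p_bernoulli n p / fact n"
proof (induction n arbitrary: p)
  case 0
  then show ?case by (simp add: bernoulli_series_def)
next
  case (Suc n)
  have "real (Suc n) * (bernoulli_series p oo expm1) $ Suc n =
      fps_deriv (bernoulli_series p oo expm1) $ n"
    by simp
  also have "\<dots> = real p * (p_bernoulli n p / fact n)
      - (real p + 1)\<^sup>2 / (real p + 2) * (p_bernoulli n (Suc p) / fact n)"
    by (simp only: fps_deriv_compose_expm1 bernoulli_series_ODE fps_compose_sub_distrib
        fps_compose_mult_distrib [OF expm1_nth_0] fps_const_compose Suc fps_sub_nth
        fps_mult_left_const_nth)
  also have "\<dots> = p_bernoulli (Suc n) p / fact n"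
    by (simp add: diff_divide_distrib)
  finally show ?case
    by (simp add: divide_simps del: p_bernoulli.simps) (simp add: algebra_simps)
qed

text \<open>For \<open>p = 0\<close> this is log(1 + u); each increase of p integrates once more in
  u with zero constant term.\<close>

definition iterated_log :: "nat \<Rightarrow> real fps" where
  "iterated_log p = fps_const (1 / fact (Suc p)) * fps_X ^ Suc p * bernoulli_series p"

lemma iterated_log_nth:
  "iterated_log p $ n = (if n \<le> p then 0 else (-1) ^ (n - Suc p) * fact (n - Suc p) / fact n)"
  by (simp add: iterated_log_def mult.assoc fps_X_power_mult_nth bernoulli_series_def
      del: power_Suc fact_Suc)

lemma fps_deriv_iterated_log_0: "(1 + fps_X) * fps_deriv (iterated_log 0) = 1"
proof (rule fps_ext)
  fix n
  have "fps_deriv (iterated_log 0) $ m = (-1) ^ m" for m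
    by (simp add: iterated_log_nth)
  then show "((1 + fps_X) * fps_deriv (iterated_log 0)) $ n = 1 $ n"
    by (cases n) (simp_all add: distrib_right del: fps_deriv_nth)
qed

lemma fps_deriv_iterated_log_Suc: "fps_deriv (iterated_log (Suc p)) = iterated_log p"
  by (rule fps_ext) (simp add: iterated_log_nth)

text \<open>Since 1 + u = e^t, differentiating u^(m+1)/(m+1)! in t lowers the index and produces the
  same factor e^t as for \<open>iterated_log\<close>.\<close>

lemma fps_deriv_expm1_divided_power:
  "fps_deriv (fps_const (1 / fact (Suc m)) * expm1 ^ Suc m) =
     fps_exp 1 * (fps_const (1 / fact m) * expm1 ^ m)"
proof -
  have "expm1 ^ Suc m + expm1 ^ m = fps_exp 1 * expm1 ^ m"
    by (simp add: expm1_def algebra_simps)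
  then have "fps_deriv (fps_const (1 / fact (Suc m)) * expm1 ^ Suc m) =
      fps_const (1 / fact (Suc m)) * (fps_const (real (Suc m)) * (fps_exp 1 * expm1 ^ m))"
    by (simp only: fps_deriv_mult_const_left fps_deriv_expm1_power_Suc fps_of_nat [symmetric])
  also have "\<dots> = fps_exp 1 * (fps_const (1 / fact (Suc m) * real (Suc m)) * expm1 ^ m)"
    by (simp only: fps_const_mult [symmetric] mult_ac)
  also have "1 / fact (Suc m) * real (Suc m) = 1 / fact m"
    by simp
  finally show ?thesis .
qed

definition log_closed_form :: "nat \<Rightarrow> real fps" where
  "log_closed_form p = fps_const (1 / fact p) * fps_exp (real p) * (fps_X - fps_const (harm p))
     + (\<Sum>j\<le>p. fps_const (harm j / fact j) * (fps_const (1 / fact (p - j)) * expm1 ^ (p - j)))"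

lemma fps_deriv_log_closed_form_Suc:
  "fps_deriv (log_closed_form (Suc p)) = fps_exp 1 * log_closed_form p"
proof -
  have exp_Suc: "fps_exp (real (Suc p)) = fps_exp 1 * fps_exp (real p)"
    by (simp add: fps_exp_add_mult [symmetric])
  have "fps_deriv (fps_const (1 / fact (Suc p)) * fps_exp (real (Suc p)) *
        (fps_X - fps_const (harm (Suc p))))
      = fps_exp (real (Suc p)) * (fps_const (1 / fact (Suc p)) *
          (fps_const (real (Suc p)) * (fps_X - fps_const (harm (Suc p))) + 1))"
    by (simp add: algebra_simps del: fps_const_mult fps_const_sub fact_Suc of_nat_Suc)
  \<comment> \<open>Here H_{p+1} turns into H_p: (p + 1) H_{p+1} - 1 = (p + 1) H_p.\<close>
  also have "fps_const (1 / fact (Suc p)) *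
        (fps_const (real (Suc p)) * (fps_X - fps_const (harm (Suc p))) + 1)
      = fps_const (1 / fact p) * (fps_X - fps_const (harm p))"
    by (rule fps_ext)
      (simp add: harm_Suc fps_X_def divide_simps del: fps_const_mult fps_const_sub)
  finally have log_part: "fps_deriv (fps_const (1 / fact (Suc p)) * fps_exp (real (Suc p)) *
      (fps_X - fps_const (harm (Suc p)))) =
      fps_exp 1 * (fps_const (1 / fact p) * fps_exp (real p) * (fps_X - fps_const (harm p)))"
    by (simp only: exp_Suc mult_ac)
  \<comment> \<open>The summand \<open>j = Suc p\<close> is constant, so its derivative drops
    out.\<close>
  have "fps_deriv (\<Sum>j\<le>Suc p. fps_const (harm j / fact j) *
      (fps_const (1 / fact (Suc p - j)) * expm1 ^ (Suc p - j)))
    = (\<Sum>j\<le>p. fps_const (harm j / fact j) *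
        fps_deriv (fps_const (1 / fact (Suc (p - j))) * expm1 ^ Suc (p - j)))"
    by (simp add: fps_deriv_sum Suc_diff_le del: fps_const_mult power_Suc fact_Suc)
  also have "\<dots> = fps_exp 1 * (\<Sum>j\<le>p. fps_const (harm j / fact j) *
      (fps_const (1 / fact (p - j)) * expm1 ^ (p - j)))"
    by (simp only: fps_deriv_expm1_divided_power sum_distrib_left) (simp only: mult_ac)
  finally show ?thesis
    unfolding log_closed_form_def fps_deriv_add log_part by (simp only: distrib_left)
qed

text \<open>Induction on p: both sides have the same derivative in t and vanish at t = 0.\<close>

lemma iterated_log_compose_expm1: "iterated_log p oo expm1 = log_closed_form p"
proof (induction p)
  case 0
  have "fps_deriv (iterated_log 0 oo expm1) = fps_deriv fps_X"
    by (simp add: fps_deriv_compose_expm1 fps_deriv_iterated_log_0)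
  then have "iterated_log 0 oo expm1 = fps_X"
    unfolding fps_deriv_eq_iff by (simp add: iterated_log_nth)
  then show ?case
    by (simp add: log_closed_form_def harm_def)
next
  case (Suc p)
  have "fps_deriv (iterated_log (Suc p) oo expm1) = fps_exp 1 * log_closed_form p"
    using Suc by (simp add: fps_compose_deriv fps_deriv_iterated_log_Suc fps_deriv_expm1 expm1_def)
  then have "fps_deriv (iterated_log (Suc p) oo expm1) = fps_deriv (log_closed_form (Suc p))"
    by (simp only: fps_deriv_log_closed_form_Suc)
  \<comment> \<open>At t = 0 only the summand \<open>j = Suc p\<close> survives, and it cancels the
    harmonic term of the exponential part.\<close>
  moreover have "log_closed_form (Suc p) $ 0 = 0"
  proof -
    have "(\<Sum>j\<le>Suc p. harm j / fact j * (1 / fact (Suc p - j) * (expm1 ^ (Suc p - j)) $ 0))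
        = (\<Sum>j\<in>{Suc p}. harm j / fact j :: real)"
      by (rule sum.mono_neutral_cong_right) (auto simp: fps_nth_power_0)
    then show ?thesis
      by (simp add: log_closed_form_def fps_sum_nth mult.assoc del: sum.atMost_Suc fps_const_mult fact_Suc)
  qed
  ultimately show ?case
    unfolding fps_deriv_eq_iff by (simp add: iterated_log_nth)
qed

lemma log_closed_form_nth:
  assumes "n > 0"
  shows "fact n * log_closed_form p $ n =
    real p ^ (n - 1) * (real n - real p * harm p) / fact p
    + (\<Sum>j\<le>p. real (Stirling n (p - j)) * (harm j / fact j))"
proof -
  obtain m where n: "n = Suc m"
    using assms by (cases n) auto
  have "fact n / fact m = real n"
    by (simp add: n)
  then have "fact n * (real p ^ m / fact m) = real n * real p ^ m"
    by (metis times_divide_eq_left times_divide_eq_right)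
  \<comment> \<open>The terms come from t e^(pt) and H_p e^(pt); \<open>p ^ m\<close> with m = n - 1
    is their common factor, and 0^0 = 1 covers p = 0, n = 1.\<close>
  then have "fact n * (real p ^ m / fact m - harm p * real p ^ n / fact n) =
      real p ^ m * (real n - real p * harm p)"
    by (simp add: right_diff_distrib n del: fact_Suc of_nat_Suc)
  moreover have "(fps_const (1 / fact p) * fps_exp (real p) * (fps_X - fps_const (harm p))) $ n =
      (real p ^ m / fact m - harm p * real p ^ n / fact n) / fact p"
    by (simp add: n mult.assoc right_diff_distrib diff_divide_distrib mult_ac
        del: fact_Suc power_Suc)
  ultimately have
    "fact n * (fps_const (1 / fact p) * fps_exp (real p) * (fps_X - fps_const (harm p))) $ n =
      real p ^ (n - 1) * (real n - real p * harm p) / fact p"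
    by (simp add: n del: fact_Suc of_nat_Suc power_Suc)
  moreover have "fact n * (\<Sum>j\<le>p. fps_const (harm j / fact j) *
      (fps_const (1 / fact (p - j)) * expm1 ^ (p - j))) $ n =
      (\<Sum>j\<le>p. real (Stirling n (p - j)) * (harm j / fact j))"
    unfolding fps_sum_nth sum_distrib_left fps_mult_left_const_nth fps_nth_expm1_power
    by (simp add: mult_ac)
  ultimately show ?thesis
    by (simp only: log_closed_form_def fps_add_nth distrib_left)
qed

theorem theorem3:
  fixes n p :: nat
  assumes "p < n"
  shows "(\<Sum>k=p+1..n. real (n choose k) * real (Stirling k (p + 1)) * p_bernoulli (n - k) p) =
         real p ^ (n - 1) * (real n - real p * harm p) / fact p
         + (\<Sum>j=1..p. real (Stirling n (p - j)) * (harm j / fact j))"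
proof -
  have "iterated_log p oo expm1 =
      fps_const (1 / fact (Suc p)) * (expm1 ^ Suc p * (bernoulli_series p oo expm1))"
    by (simp add: iterated_log_def fps_compose_mult_distrib fps_compose_power [symmetric] mult.assoc
        del: power_Suc)
  \<comment> \<open>The Cauchy product; its factorials combine to the binomial coefficient.\<close>
  then have "fact n * (iterated_log p oo expm1) $ n =
      (\<Sum>k=0..n. fact n * (real (Stirling k (Suc p)) / fact k * (p_bernoulli (n - k) p / fact (n - k))))"
    by (simp add: fps_mult_nth [of "expm1 ^ Suc p"] fps_nth_expm1_power p_bernoulli_egf sum_distrib_left
        sum_divide_distrib del: power_Suc fact_Suc)
  also have "\<dots> = (\<Sum>k=0..n. real (n choose k) * real (Stirling k (p + 1)) * p_bernoulli (n - k) p)"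
    by (intro sum.cong) (simp_all add: binomial_fact)
  \<comment> \<open>Stirling numbers \<open>Stirling k (p + 1)\<close> vanish for k \<le> p.\<close>
  also have "\<dots> = (\<Sum>k=p+1..n. real (n choose k) * real (Stirling k (p + 1)) * p_bernoulli (n - k) p)"
    by (intro sum.mono_neutral_right) auto
  finally have lhs: "fact n * (iterated_log p oo expm1) $ n = \<dots>" .

  \<comment> \<open>The term j = 0 vanishes because H_0 = 0.\<close>
  have "(\<Sum>j\<le>p. real (Stirling n (p - j)) * (harm j / fact j)) =
      (\<Sum>j=1..p. real (Stirling n (p - j)) * (harm j / fact j))"
    by (intro sum.mono_neutral_right) (auto simp: harm_def Suc_le_eq)
  then show ?thesis
    using lhs log_closed_form_nth [of n p] assms by (simp add: iterated_log_compose_expm1)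
qed

end
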